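(* Consider the inexact infeasible primal-dual regularized interior point method (Algorithm 2) described in the context, applied to the regularized problem PPM$(k)$, and let $\mu^j=(\mathbf x^j)^T\mathbf s^j/n$ be the complementarity measure of its $j$-th iterate. Algorithm 2 has polynomial complexity: given $\varepsilon>0$, there exists $K\in O\big(n^2\ln(\tfrac1\varepsilon)\big)$ such that $\mu^j\le\varepsilon$ for all $j\ge K$. Here $K\in O(n^2\ln(1/\varepsilon))$ means that there exist $\varepsilon_0\in(0,1)$ and a constant $C>0$, where $C$ does not depend on $\varepsilon$, and depends on the problem only through $\rho,\delta,\|A\|,\bar\gamma,\underline\gamma,\gamma_p,\gamma_d,\sigma,\bar\sigma,C_{\text{inexact}},\mu^0$ (and not otherwise on $n$), such that $K\le C\,n^2\ln(1/\varepsilon)$ for all $\varepsilon\in(0,\varepsilon_0]$.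
   Context: Setting. Let $A\in\mathbb R^{m\times n}$ with $m\le n$ (not necessarily of full rank), $\mathbf b\in\mathbb R^m$, $\mathbf c\in\mathbb R^n$, $\rho,\delta>0$, and let $\mathbf x_k\in\mathbb R^n$, $\mathbf y_k\in\mathbb R^m$ be fixed. Problem PPM$(k)$ is: minimize $\mathbf c^T\mathbf x+\frac\rho2\|\mathbf x-\mathbf x_k\|^2+\frac\delta2\|\mathbf y\|^2$ over $\mathbf x\in\mathbb R^n,\mathbf y\in\mathbb R^m$ subject to $A\mathbf x+\delta(\mathbf y-\mathbf y_k)=\mathbf b$, $\mathbf x\ge0$. $\|\cdot\|$ is the Euclidean (spectral) norm, $\mathbf e$ the all-ones vector. A triple $(\mathbf x^*,\mathbf y^*,\mathbf s^* )$ is a solution of PPM$(k)$ if $A\mathbf x^*+\delta(\mathbf y^*-\mathbf y_k)-\mathbf b=0$, $\rho(\mathbf x^*-\mathbf x_k)-A^T\mathbf y^*-\mathbf s^*+\mathbf c=0$, $(\mathbf x^* )^T\mathbf s^*=0$, and $\mathbf x^*,\mathbf s^*\ge0$. Parameters: $0<\underline\gamma<1<\bar\gamma$, $\gamma_p,\gamma_d>0$, $0<\sigma<\bar\sigma<1$, $C_{\text{inexact}}\in(0,1)$ with $\gamma_pC_{\text{inexact}}<\sigma$. Neighbourhood: $\mathcal N_k=\mathcal N_k(\bar\gamma,\underline\gamma,\gamma_p,\gamma_d)$ is the set of $(\mathbf x,\mathbf y,\mathbf s)\in\mathbb R^n_{>0}\times\mathbb R^m\times\mathbb R^n_{>0}$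 with $\bar\gamma\,\mathbf x^T\mathbf s/n\ge x_is_i\ge\underline\gamma\,\mathbf x^T\mathbf s/n$ for all $i$, $\mathbf x^T\mathbf s\ge\gamma_p\|A\mathbf x+\delta(\mathbf y-\mathbf y_k)-\mathbf b\|$ and $\mathbf x^T\mathbf s\ge\gamma_d\|\rho(\mathbf x-\mathbf x_k)-A^T\mathbf y-\mathbf s+\mathbf c\|$. Inexact Newton direction at $(\mathbf x,\mathbf y,\mathbf s)$ with $\mathbf x,\mathbf s>0$: put $X=\mathrm{diag}(\mathbf x)$, $S=\mathrm{diag}(\mathbf s)$, $\mu=\mathbf x^T\mathbf s/n$, $\boldsymbol\xi_d=-(\rho(\mathbf x-\mathbf x_k)-A^T\mathbf y-\mathbf s+\mathbf c)$, $\boldsymbol\xi_p=-(A\mathbf x+\delta(\mathbf y-\mathbf y_k)-\mathbf b)$, $\boldsymbol\xi_{\mu,\sigma}=-(SX\mathbf e-\sigma\mu\mathbf e)$. An inexact Newton direction is $(\Delta\mathbf x,\Delta\mathbf y,\Delta\mathbf s)$ with $\rho\Delta\mathbf x-A^T\Delta\mathbf y-\Delta\mathbf s=\boldsymbol\xi_d$, $A\Delta\mathbf x+\delta\Delta\mathbf y=\boldsymbol\xi_p+\boldsymbol\zeta$, $S\Delta\mathbf x+X\Delta\mathbf s=\boldsymbol\xi_{\mu,\sigma}$, for some $\boldsymbol\zeta$ with $\|\boldsymbol\zeta\|\le C_{\text{inexact}}\mathbf x^T\mathbf s$. Write $(\mathbf x(\alpha),\mathbf y(\alpha),\mathbf s(\alpha))=(\mathbf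 x,\mathbf y,\mathbf s)+\alpha(\Delta\mathbf x,\Delta\mathbf y,\Delta\mathbf s)$. Algorithm 2: start from $(\mathbf x^0,\mathbf y^0,\mathbf s^0)\in\mathcal N_k$. At iteration $j$, compute an inexact Newton direction at $(\mathbf x^j,\mathbf y^j,\mathbf s^j)$. Let $\alpha^{*,j}=\min\{\sup\{\alpha:\mathbf x^j(\alpha)\ge0\},\sup\{\alpha:\mathbf s^j(\alpha)\ge0\}\}$; if $\alpha^{*,j}<\infty$ and $(\mathbf x^j(\alpha^{*,j}),\mathbf y^j(\alpha^{*,j}),\mathbf s^j(\alpha^{*,j}))$ is a solution of PPM$(k)$, stop. Otherwise let $\alpha^j$ be the maximum $\alpha\in[0,1]$ such that for all $\alpha'\in[0,\alpha]$: $(\mathbf x^j(\alpha'),\mathbf y^j(\alpha'),\mathbf s^j(\alpha'))\in\mathcal N_k$ and $\mathbf x^j(\alpha')^T\mathbf s^j(\alpha')\le(1-(1-\bar\sigma)\alpha')(\mathbf x^j)^T\mathbf s^j$. Set $(\mathbf x^{j+1},\mathbf y^{j+1},\mathbf s^{j+1})=(\mathbf x^j(\alpha^j),\mathbf y^j(\alpha^j),\mathbf s^j(\alpha^j))$ and continue. The statement concerns the infinite sequence of iterates produced when the method does not stop. *)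

theory Defs
  imports
    Complex_Main
    "HOL-Library.Extended_Real"
    "Jordan_Normal_Form.Matrix"
begin

(* The complexity constant must be uniform in the dimensions m and n, so the dimensions have to be
   quantified inside the statement. Hence vectors and matrices with explicit carriers rather than
   the type-indexed real ^ 'n. *)

definition norm2_vec :: "real vec \<Rightarrow> real" where
  "norm2_vec v = sqrt (v \<bullet> v)"

definition spectral_norm :: "real mat \<Rightarrow> real" where
  "spectral_norm A = (SUP v \<in> {v \<in> carrier_vec (dim_col A). norm2_vec v \<le> 1}. norm2_vec (A *\<^sub>v v))"

(* Data of: minimise c^T x + rho/2 ||x - x_k||^2 + delta/2 ||y||^2
   subject to A x + delta (y - y_k) = b, x >= 0. *)
record ppm =
  cmat :: "real mat"      (* A *)
  rhs :: "real vec"       (* b *)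
  cost :: "real vec"      (* c *)
  preg :: real            (* rho *)
  dreg :: real            (* delta *)
  pcenter :: "real vec"   (* x_k *)
  dcenter :: "real vec"   (* y_k *)

definition ppm_problem :: "nat \<Rightarrow> nat \<Rightarrow> ppm \<Rightarrow> bool" where
  "ppm_problem m n P \<longleftrightarrow>
     0 < m \<and> m \<le> n \<and>
     cmat P \<in> carrier_mat m n \<and> rhs P \<in> carrier_vec m \<and> cost P \<in> carrier_vec n \<and>
     0 < preg P \<and> 0 < dreg P \<and>
     pcenter P \<in> carrier_vec n \<and> dcenter P \<in> carrier_vec m"

abbreviation ppm_rows :: "ppm \<Rightarrow> nat" where
  "ppm_rows P \<equiv> dim_row (cmat P)"

abbreviation ppm_cols :: "ppm \<Rightarrow> nat" where
  "ppm_cols P \<equiv> dim_col (cmat P)"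

definition primal_res :: "ppm \<Rightarrow> real vec \<Rightarrow> real vec \<Rightarrow> real vec" where
  "primal_res P x y = cmat P *\<^sub>v x + dreg P \<cdot>\<^sub>v (y - dcenter P) - rhs P"

definition dual_res :: "ppm \<Rightarrow> real vec \<Rightarrow> real vec \<Rightarrow> real vec \<Rightarrow> real vec" where
  "dual_res P x y s = preg P \<cdot>\<^sub>v (x - pcenter P) - (cmat P)\<^sup>T *\<^sub>v y - s + cost P"

definition ppm_solution :: "ppm \<Rightarrow> real vec \<Rightarrow> real vec \<Rightarrow> real vec \<Rightarrow> bool" where
  "ppm_solution P x y s \<longleftrightarrow>
     x \<in> carrier_vec (ppm_cols P) \<and> y \<in> carrier_vec (ppm_rows P) \<and> s \<in> carrier_vec (ppm_cols P) \<and>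
     primal_res P x y = 0\<^sub>v (ppm_rows P) \<and>
     dual_res P x y s = 0\<^sub>v (ppm_cols P) \<and>
     x \<bullet> s = 0 \<and> 0\<^sub>v (ppm_cols P) \<le> x \<and> 0\<^sub>v (ppm_cols P) \<le> s"

record ipm_params =
  gamma_lo :: real
  gamma_up :: real
  gamma_p :: real
  gamma_d :: real
  sigma :: real
  sigma_bar :: real
  C_inexact :: real

definition valid_params :: "ipm_params \<Rightarrow> bool" where
  "valid_params q \<longleftrightarrow>
     0 < gamma_lo q \<and> gamma_lo q < 1 \<and> 1 < gamma_up q \<and>
     0 < gamma_p q \<and> 0 < gamma_d q \<and>
     0 < sigma q \<and> sigma q < sigma_bar q \<and> sigma_bar q < 1 \<and>
     0 < C_inexact q \<and> C_inexact q < 1 \<and> gamma_p q * C_inexact q < sigma q"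

definition compl_measure :: "real vec \<Rightarrow> real vec \<Rightarrow> real" where
  "compl_measure x s = (x \<bullet> s) / real (dim_vec x)"

(* Strict positivity is written componentwise: the library's < on vectors is
   "\<le> and not equal", not the componentwise strict order. *)
definition neighbourhood :: "ppm \<Rightarrow> ipm_params \<Rightarrow> (real vec \<times> real vec \<times> real vec) set" where
  "neighbourhood P q = {(x, y, s).
     x \<in> carrier_vec (ppm_cols P) \<and> y \<in> carrier_vec (ppm_rows P) \<and> s \<in> carrier_vec (ppm_cols P) \<and>
     (\<forall>i < ppm_cols P. 0 < x $ i \<and> 0 < s $ i) \<and>
     (\<forall>i < ppm_cols P. gamma_up q * compl_measure x s \<ge> x $ i * s $ i \<and>
                     x $ i * s $ i \<ge> gamma_lo q * compl_measure x s) \<and>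
     x \<bullet> s \<ge> gamma_p q * norm2_vec (primal_res P x y) \<and>
     x \<bullet> s \<ge> gamma_d q * norm2_vec (dual_res P x y s)}"

definition diag_of_vec :: "real vec \<Rightarrow> real mat" where
  "diag_of_vec v = mat_diag (dim_vec v) (\<lambda>i. v $ i)"

definition ones_vec :: "nat \<Rightarrow> real vec" where
  "ones_vec n = vec n (\<lambda>_. 1)"

definition inexact_newton ::
  "ppm \<Rightarrow> ipm_params \<Rightarrow> real vec \<Rightarrow> real vec \<Rightarrow> real vec \<Rightarrow> real vec \<Rightarrow> real vec \<Rightarrow> real vec \<Rightarrow> bool" where
  "inexact_newton P q x y s dx dy ds \<longleftrightarrow>
     dx \<in> carrier_vec (ppm_cols P) \<and> dy \<in> carrier_vec (ppm_rows P) \<and> ds \<in> carrier_vec (ppm_cols P) \<and>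
     preg P \<cdot>\<^sub>v dx - (cmat P)\<^sup>T *\<^sub>v dy - ds = - dual_res P x y s \<and>
     (\<exists>z \<in> carrier_vec (ppm_rows P).
        norm2_vec z \<le> C_inexact q * (x \<bullet> s) \<and>
        cmat P *\<^sub>v dx + dreg P \<cdot>\<^sub>v dy = - primal_res P x y + z) \<and>
     diag_of_vec s *\<^sub>v dx + diag_of_vec x *\<^sub>v ds =
       - (diag_of_vec s *\<^sub>v (diag_of_vec x *\<^sub>v ones_vec (ppm_cols P))
          - (sigma q * compl_measure x s) \<cdot>\<^sub>v ones_vec (ppm_cols P))"

(* sup over the extended reals, so that an unblocked direction gives \<infinity> *)
definition max_nonneg_step :: "real vec \<Rightarrow> real vec \<Rightarrow> ereal" where
  "max_nonneg_step v dv = (SUP \<alpha> \<in> {\<alpha> :: real. 0\<^sub>v (dim_vec v) \<le> v + \<alpha> \<cdot>\<^sub>v dv}. ereal \<alpha>)"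

definition alpha_star :: "real vec \<Rightarrow> real vec \<Rightarrow> real vec \<Rightarrow> real vec \<Rightarrow> ereal" where
  "alpha_star x s dx ds = min (max_nonneg_step x dx) (max_nonneg_step s ds)"

definition stops ::
  "ppm \<Rightarrow> real vec \<Rightarrow> real vec \<Rightarrow> real vec \<Rightarrow> real vec \<Rightarrow> real vec \<Rightarrow> real vec \<Rightarrow> bool" where
  "stops P x y s dx dy ds \<longleftrightarrow>
     alpha_star x s dx ds < \<infinity> \<and>
     (let \<alpha> = real_of_ereal (alpha_star x s dx ds)
      in ppm_solution P (x + \<alpha> \<cdot>\<^sub>v dx) (y + \<alpha> \<cdot>\<^sub>v dy) (s + \<alpha> \<cdot>\<^sub>v ds))"

definition admissible_steps ::
  "ppm \<Rightarrow> ipm_params \<Rightarrow> real vec \<Rightarrow> real vec \<Rightarrow> real vec \<Rightarrow> real vec \<Rightarrow> real vec \<Rightarrow> real vec \<Rightarrow> real set" where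
  "admissible_steps P q x y s dx dy ds = {\<alpha> \<in> {0..1}. \<forall>\<beta> \<in> {0..\<alpha>}.
     (x + \<beta> \<cdot>\<^sub>v dx, y + \<beta> \<cdot>\<^sub>v dy, s + \<beta> \<cdot>\<^sub>v ds) \<in> neighbourhood P q \<and>
     (x + \<beta> \<cdot>\<^sub>v dx) \<bullet> (s + \<beta> \<cdot>\<^sub>v ds) \<le> (1 - (1 - sigma_bar q) * \<beta>) * (x \<bullet> s)}"

(* (x j, y j, s j) is the sequence of iterates of an execution that never stops; the Newton
   direction is an arbitrary one meeting the inexactness tolerance. *)
definition infinite_ipm_run ::
  "ppm \<Rightarrow> ipm_params \<Rightarrow> (nat \<Rightarrow> real vec) \<Rightarrow> (nat \<Rightarrow> real vec) \<Rightarrow> (nat \<Rightarrow> real vec) \<Rightarrow> bool" where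
  "infinite_ipm_run P q x y s \<longleftrightarrow>
     (x 0, y 0, s 0) \<in> neighbourhood P q \<and>
     (\<forall>j. \<exists>dx dy ds \<alpha>.
        inexact_newton P q (x j) (y j) (s j) dx dy ds \<and>
        \<not> stops P (x j) (y j) (s j) dx dy ds \<and>
        \<alpha> \<in> admissible_steps P q (x j) (y j) (s j) dx dy ds \<and>
        (\<forall>\<beta> \<in> admissible_steps P q (x j) (y j) (s j) dx dy ds. \<beta> \<le> \<alpha>) \<and>
        x (Suc j) = x j + \<alpha> \<cdot>\<^sub>v dx \<and>
        y (Suc j) = y j + \<alpha> \<cdot>\<^sub>v dy \<and>
        s (Suc j) = s j + \<alpha> \<cdot>\<^sub>v ds)"

end

theory Submission
  imports Defs "HOL-Analysis.L2_Norm"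
begin

text \<open>
  Along a Newton direction with step \<open>\<beta>\<close>, each product of complementary variables becomes
  \<open>(1 - \<beta>) x\<^sub>i s\<^sub>i + \<beta> \<sigma> \<mu> + \<beta>\<^sup>2 dx\<^sub>i ds\<^sub>i\<close>, while both residuals
  shrink by the factor \<open>1 - \<beta>\<close>, the primal one up to the error \<open>\<beta> z\<close> of the inexact solve.
  Hence every neighbourhood condition, and the required decrease of \<open>x \<bullet> s\<close>, holds up to first
  order in \<open>\<beta>\<close> with a slack proportional to \<open>\<beta> \<mu>\<close>, and only the second-order term has to be
  controlled (\<open>newton_step_in_neighbourhood\<close>).

  The decisive estimate is \<open>sum_abs_newton_products_le\<close>: as long as \<open>\<mu> \<le> M\<close>, the sum of all \<open>\<bar>dx\<^sub>i ds\<^sub>i\<bar>\<close> is at most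
  \<open>c n\<^sup>2 \<mu>\<close> with \<open>c\<close> independent of the dimensions. The complementarity equation bounds
  \<open>\<bar>dx\<^sub>i ds\<^sub>i\<bar> + dx\<^sub>i ds\<^sub>i\<close>, so a lower bound on \<open>dx \<bullet> ds\<close> suffices. Eliminating \<open>ds\<close> and \<open>dy\<close>,
  \<open>dx \<bullet> ds = \<rho> \<parallel>dx\<parallel>\<^sup>2 + (\<parallel>A dx\<parallel>\<^sup>2 - A dx \<bullet> p) / \<delta> + dx \<bullet> r\<close>, where \<open>p\<close> is the right-hand side of the
  primal Newton equation and \<open>r\<close> the dual residual. Both squared terms are nonnegative, and
  completing squares leaves \<open>- \<parallel>p\<parallel>\<^sup>2 / (4 \<delta>) - \<parallel>r\<parallel>\<^sup>2 / (4 \<rho>)\<close>; no bound on the norm of \<open>A\<close> is needed.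
  The neighbourhood and the tolerance on \<open>z\<close> give \<open>\<parallel>p\<parallel>, \<parallel>r\<parallel> = O(n \<mu>)\<close>, and \<open>(n \<mu>)\<^sup>2 \<le> M n\<^sup>2 \<mu>\<close>.

  Every step is therefore at least a constant over \<open>n\<^sup>2\<close>. Since \<open>\<mu>\<close> decreases, \<open>M\<close> may be taken to
  be its initial value \<open>\<mu>\<^sub>0\<close>, and \<open>\<mu>\<^sub>j \<le> \<mu>\<^sub>0 exp (- j \<kappa> / n\<^sup>2)\<close> (\<open>compl_measure_le_exp\<close>).
\<close>

section \<open>Euclidean norms and diagonal matrices\<close>

lemma norm2_vec_eq_L2_set: "norm2_vec v = L2_set (\<lambda>i. v $ i) {0..<dim_vec v}"
  by (simp add: norm2_vec_def L2_set_def scalar_prod_def power2_eq_square)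

lemma norm2_vec_nonneg: "0 \<le> norm2_vec v"
  by (simp add: norm2_vec_eq_L2_set)

lemma norm2_vec_squared: "(norm2_vec v)\<^sup>2 = (\<Sum>i<dim_vec v. (v $ i)\<^sup>2)"
  by (simp add: norm2_vec_eq_L2_set L2_set_def sum_nonneg atLeast0LessThan)

lemma norm2_vec_add_le:
  assumes "v \<in> carrier_vec n" "w \<in> carrier_vec n"
  shows "norm2_vec (v + w) \<le> norm2_vec v + norm2_vec w"
proof -
  have "norm2_vec (v + w) = L2_set (\<lambda>i. v $ i + w $ i) {0..<n}"
    using assms by (auto simp: norm2_vec_eq_L2_set intro!: L2_set_cong)
  also have "\<dots> \<le> L2_set (\<lambda>i. v $ i) {0..<n} + L2_set (\<lambda>i. w $ i) {0..<n}"
    by (rule L2_set_triangle_ineq)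
  finally show ?thesis
    using assms by (simp add: norm2_vec_eq_L2_set)
qed

lemma norm2_vec_smult:
  assumes "0 \<le> a"
  shows "norm2_vec (a \<cdot>\<^sub>v v) = a * norm2_vec v"
proof -
  have "norm2_vec (a \<cdot>\<^sub>v v) = L2_set (\<lambda>i. a * v $ i) {0..<dim_vec v}"
    by (auto simp: norm2_vec_eq_L2_set intro!: L2_set_cong)
  then show ?thesis
    using assms by (simp add: L2_set_right_distrib norm2_vec_eq_L2_set)
qed

lemma norm2_vec_uminus: "norm2_vec (- v) = norm2_vec v"
  by (simp add: norm2_vec_eq_L2_set L2_set_def)

lemma dim_row_diag_of_vec [simp]: "dim_row (diag_of_vec v) = dim_vec v"
  by (simp add: diag_of_vec_def mat_diag_def)

lemma diag_of_vec_mult_index: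
  assumes "v \<in> carrier_vec n" "w \<in> carrier_vec n" "i < n"
  shows "(diag_of_vec v *\<^sub>v w) $ i = v $ i * w $ i"
proof -
  have "(diag_of_vec v *\<^sub>v w) $ i = (\<Sum>j<n. (if i = j then v $ j else 0) * w $ j)"
    using assms by (simp add: diag_of_vec_def mat_diag_def scalar_prod_def atLeast0LessThan)
  also have "\<dots> = (\<Sum>j<n. if j = i then v $ i * w $ i else 0)"
    by (rule sum.cong) auto
  also have "\<dots> = v $ i * w $ i"
    using assms by simp
  finally show ?thesis .
qed

section \<open>Size of the second-order term\<close>

lemma abs_prod_newton_le:
  fixes x s dx ds \<sigma> \<mu> \<gamma> :: real
  assumes "0 < x" "0 < s" "0 < \<gamma>" "0 < \<mu>" "0 < \<sigma>"
    and newton: "s * dx + x * ds = \<sigma> * \<mu> - x * s"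
    and lower: "\<gamma> * \<mu> \<le> x * s"
  shows "2 * \<bar>dx * ds\<bar> + 2 * (dx * ds) \<le> \<sigma>\<^sup>2 * \<mu> / \<gamma> + x * s"
proof -
  define t where "t = x * s"
  have t: "0 < t" using assms by (simp add: t_def)
  \<comment> \<open>Square the Newton equation: by AM-GM, \<open>(s dx + x ds)\<^sup>2\<close> dominates \<open>2 t (\<bar>dx ds\<bar> + dx ds)\<close>.\<close>
  have "2 * t * \<bar>dx * ds\<bar> = 2 * \<bar>s * dx\<bar> * \<bar>x * ds\<bar>"
    using assms by (simp add: t_def abs_mult)
  also have "\<dots> \<le> (s * dx)\<^sup>2 + (x * ds)\<^sup>2"
    using sum_squares_bound[of "\<bar>s * dx\<bar>" "\<bar>x * ds\<bar>"] by simp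
  finally have "t * (2 * \<bar>dx * ds\<bar> + 2 * (dx * ds)) \<le> (s * dx + x * ds)\<^sup>2"
    by (simp add: t_def power2_eq_square algebra_simps)
  also have "\<dots> = (\<sigma> * \<mu>)\<^sup>2 - 2 * (\<sigma> * \<mu> * t) + t\<^sup>2"
    unfolding newton t_def by (simp add: power2_eq_square algebra_simps)
  also have "\<dots> \<le> (\<sigma> * \<mu>)\<^sup>2 + t\<^sup>2"
    using assms t by simp
  also have "(\<sigma> * \<mu>)\<^sup>2 \<le> t * (\<sigma>\<^sup>2 * \<mu> / \<gamma>)"
  proof -
    have "\<gamma> * \<mu> * (\<sigma>\<^sup>2 * \<mu> / \<gamma>) \<le> t * (\<sigma>\<^sup>2 * \<mu> / \<gamma>)"
      using assms by (intro mult_right_mono) (auto simp: t_def)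
    then show ?thesis using assms by (simp add: power2_eq_square algebra_simps)
  qed
  finally have "t * (2 * \<bar>dx * ds\<bar> + 2 * (dx * ds)) \<le> t * (\<sigma>\<^sup>2 * \<mu> / \<gamma> + t)"
    by (simp add: power2_eq_square algebra_simps)
  then show ?thesis
    using t unfolding t_def by (rule mult_left_le_imp_le)
qed

lemma mult_diff_le_square_quarter: "a * (p - a) \<le> p\<^sup>2 / 4" for a p :: real
  using zero_le_power2[of "p / 2 - a"] by (simp add: power2_eq_square algebra_simps)

lemma quadratic_lower_bound:
  fixes a r \<rho> :: real
  assumes "0 < \<rho>"
  shows "- (r\<^sup>2 / (4 * \<rho>)) \<le> \<rho> * a\<^sup>2 + a * r"
proof -
  have "0 \<le> (2 * \<rho> * a + r)\<^sup>2 / (4 * \<rho>)" using assms by simp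
  also have "\<dots> = \<rho> * a\<^sup>2 + a * r + r\<^sup>2 / (4 * \<rho>)"
    using assms by (simp add: field_simps power2_eq_square)
  finally show ?thesis by simp
qed

text \<open>
  Both regularisation parameters enter: \<open>\<rho>\<close> absorbs the term of the dual residual, and \<open>\<delta>\<close>, through
  \<open>dy = (p - A dx) / \<delta>\<close>, that of the primal right-hand side.
\<close>

lemma regularised_scalar_prod_lower:
  fixes A :: "real mat" and dx dy ds r p :: "real vec" and \<rho> \<delta> :: real
  assumes A: "A \<in> carrier_mat m n" and dx: "dx \<in> carrier_vec n" and dy: "dy \<in> carrier_vec m"
    and ds: "ds \<in> carrier_vec n" and r: "r \<in> carrier_vec n" and p: "p \<in> carrier_vec m"
    and "0 < \<rho>" "0 < \<delta>"
    and dual: "\<rho> \<cdot>\<^sub>v dx - A\<^sup>T *\<^sub>v dy - ds = - r"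
    and primal: "A *\<^sub>v dx + \<delta> \<cdot>\<^sub>v dy = p"
  shows "- ((norm2_vec p)\<^sup>2 / (4 * \<delta>)) - (norm2_vec r)\<^sup>2 / (4 * \<rho>) \<le> (\<Sum>i<n. dx $ i * ds $ i)"
proof -
  define a where "a = A *\<^sub>v dx"
  define g where "g = A\<^sup>T *\<^sub>v dy"
  have a: "a \<in> carrier_vec m" unfolding a_def using A dx by (rule mult_mat_vec_carrier)
  have g: "g \<in> carrier_vec n" unfolding g_def using A dy by (intro mult_mat_vec_carrier[of _ n m]) auto
  have ds_i: "ds $ i = \<rho> * dx $ i - g $ i + r $ i" if "i < n" for i
    using arg_cong[OF dual, of "\<lambda>v. v $ i"] that dx g ds r by (simp add: g_def[symmetric])
  have dy_i: "dy $ i = (p $ i - a $ i) / \<delta>" if "i < m" for i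
    using arg_cong[OF primal, of "\<lambda>v. v $ i"] that dy a p \<open>0 < \<delta>\<close>
    by (simp add: a_def[symmetric] field_simps)
  have "(\<Sum>i<n. dx $ i * g $ i) = g \<bullet> dx"
    using dx g by (simp add: scalar_prod_def atLeast0LessThan mult.commute)
  also have "\<dots> = dy \<bullet> a"
    unfolding g_def a_def using transpose_vec_mult_scalar[OF A dx dy] .
  also have "\<dots> = (\<Sum>i<m. a $ i * (p $ i - a $ i) / \<delta>)"
    using a by (auto simp: scalar_prod_def atLeast0LessThan dy_i intro!: sum.cong)
  also have "\<dots> \<le> (\<Sum>i<m. (p $ i)\<^sup>2 / 4 / \<delta>)"
    using \<open>0 < \<delta>\<close> by (intro sum_mono divide_right_mono mult_diff_le_square_quarter) auto
  also have "\<dots> = (norm2_vec p)\<^sup>2 / (4 * \<delta>)"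
    using p by (simp add: norm2_vec_squared sum_divide_distrib)
  finally have 1: "(\<Sum>i<n. dx $ i * g $ i) \<le> (norm2_vec p)\<^sup>2 / (4 * \<delta>)" .
  have "- ((norm2_vec r)\<^sup>2 / (4 * \<rho>)) = (\<Sum>i<n. - ((r $ i)\<^sup>2 / (4 * \<rho>)))"
    using r by (simp add: norm2_vec_squared sum_divide_distrib sum_negf)
  also have "\<dots> \<le> (\<Sum>i<n. \<rho> * (dx $ i)\<^sup>2 + dx $ i * r $ i)"
    using \<open>0 < \<rho>\<close> by (intro sum_mono quadratic_lower_bound)
  also have "\<dots> = (\<Sum>i<n. dx $ i * ds $ i + dx $ i * g $ i)"
    by (rule sum.cong) (auto simp: ds_i power2_eq_square algebra_simps)
  also have "\<dots> = (\<Sum>i<n. dx $ i * ds $ i) + (\<Sum>i<n. dx $ i * g $ i)"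
    by (rule sum.distrib)
  finally show ?thesis using 1 by linarith
qed

text \<open>
  The dimension-free factor in the bound on the second-order term, valid while the complementarity
  measure is at most \<open>M\<close>. The first summand comes from the complementarity equation; the two terms
  multiplied by \<open>M\<close> come from the primal equation and from the dual residual.
\<close>

definition second_order_const :: "real \<Rightarrow> real \<Rightarrow> real \<Rightarrow> ipm_params \<Rightarrow> real" where
  "second_order_const \<rho> \<delta> M q =
     (1 / gamma_lo q + 1) / 2
     + M * ((1 / gamma_p q + C_inexact q)\<^sup>2 / (4 * \<delta>) + (1 / gamma_d q)\<^sup>2 / (4 * \<rho>))"

lemma second_order_const_ge_1:
  assumes "valid_params q" "0 < \<rho>" "0 < \<delta>" "0 \<le> M"
  shows "1 \<le> second_order_const \<rho> \<delta> M q"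
proof -
  have "1 \<le> 1 / gamma_lo q" using assms by (simp add: valid_params_def)
  moreover have "0 \<le> M * ((1 / gamma_p q + C_inexact q)\<^sup>2 / (4 * \<delta>) + (1 / gamma_d q)\<^sup>2 / (4 * \<rho>))"
    using assms by (intro mult_nonneg_nonneg add_nonneg_nonneg divide_nonneg_nonneg) auto
  ultimately show ?thesis unfolding second_order_const_def by (simp add: add_increasing2)
qed

lemma inexact_newtonE:
  assumes "inexact_newton P q x y s dx dy ds" and "ppm_problem m n P"
    and "x \<in> carrier_vec n" "s \<in> carrier_vec n"
  obtains z where "dx \<in> carrier_vec n" "dy \<in> carrier_vec m" "ds \<in> carrier_vec n"
    "z \<in> carrier_vec m" "norm2_vec z \<le> C_inexact q * (x \<bullet> s)"
    "preg P \<cdot>\<^sub>v dx - (cmat P)\<^sup>T *\<^sub>v dy - ds = - dual_res P x y s"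
    "cmat P *\<^sub>v dx + dreg P \<cdot>\<^sub>v dy = - primal_res P x y + z"
    "\<And>i. i < n \<Longrightarrow> s $ i * dx $ i + x $ i * ds $ i = sigma q * compl_measure x s - x $ i * s $ i"
proof -
  have dims: "ppm_rows P = m" "ppm_cols P = n"
    using assms(2) by (auto simp: ppm_problem_def)
  from assms(1) obtain z where z: "z \<in> carrier_vec m" "norm2_vec z \<le> C_inexact q * (x \<bullet> s)"
    "cmat P *\<^sub>v dx + dreg P \<cdot>\<^sub>v dy = - primal_res P x y + z"
    and d: "dx \<in> carrier_vec n" "dy \<in> carrier_vec m" "ds \<in> carrier_vec n"
    and dual: "preg P \<cdot>\<^sub>v dx - (cmat P)\<^sup>T *\<^sub>v dy - ds = - dual_res P x y s"
    and compl: "diag_of_vec s *\<^sub>v dx + diag_of_vec x *\<^sub>v ds =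
       - (diag_of_vec s *\<^sub>v (diag_of_vec x *\<^sub>v ones_vec n)
          - (sigma q * compl_measure x s) \<cdot>\<^sub>v ones_vec n)"
    unfolding inexact_newton_def dims by blast
  have "s $ i * dx $ i + x $ i * ds $ i = sigma q * compl_measure x s - x $ i * s $ i"
    if i: "i < n" for i
  proof -
    have one: "ones_vec n \<in> carrier_vec n" "ones_vec n $ i = 1"
      using i by (simp_all add: ones_vec_def)
    have x1: "(diag_of_vec x *\<^sub>v ones_vec n) $ i = x $ i"
      using diag_of_vec_mult_index[OF assms(3) one(1) i] one(2) by simp
    have "diag_of_vec x *\<^sub>v ones_vec n \<in> carrier_vec n"
      using carrier_vecD[OF assms(3)] by (intro carrier_vecI) simp
    note sx1 = diag_of_vec_mult_index[OF assms(4) this i, unfolded x1]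
    have "(diag_of_vec s *\<^sub>v dx + diag_of_vec x *\<^sub>v ds) $ i = s $ i * dx $ i + x $ i * ds $ i"
      using i carrier_vecD[OF assms(3)] diag_of_vec_mult_index[OF assms(4) d(1) i] diag_of_vec_mult_index[OF assms(3) d(3) i]
      by simp
    moreover have "(- (diag_of_vec s *\<^sub>v (diag_of_vec x *\<^sub>v ones_vec n)
          - (sigma q * compl_measure x s) \<cdot>\<^sub>v ones_vec n)) $ i
        = sigma q * compl_measure x s - x $ i * s $ i"
      using i carrier_vecD[OF assms(4)] carrier_vecD[OF one(1)] by (simp add: sx1 one(2))
    ultimately show ?thesis using compl by simp
  qed
  then show thesis using that z d dual by blast
qed

lemma neighbourhoodE:
  assumes "(x, y, s) \<in> neighbourhood P q" and "ppm_problem m n P"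
  obtains "x \<in> carrier_vec n" "y \<in> carrier_vec m" "s \<in> carrier_vec n"
    "\<And>i. i < n \<Longrightarrow> 0 < x $ i" "\<And>i. i < n \<Longrightarrow> 0 < s $ i"
    "\<And>i. i < n \<Longrightarrow> x $ i * s $ i \<le> gamma_up q * compl_measure x s"
    "\<And>i. i < n \<Longrightarrow> gamma_lo q * compl_measure x s \<le> x $ i * s $ i"
    "gamma_p q * norm2_vec (primal_res P x y) \<le> x \<bullet> s"
    "gamma_d q * norm2_vec (dual_res P x y s) \<le> x \<bullet> s"
    "x \<bullet> s = real n * compl_measure x s" "0 < compl_measure x s"
proof -
  have n: "0 < n" and dims: "ppm_rows P = m" "ppm_cols P = n"
    using assms(2) by (auto simp: ppm_problem_def)
  note nb = assms(1)[unfolded neighbourhood_def dims, simplified]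
  have xs: "x \<bullet> s = real n * compl_measure x s"
    using nb n by (auto simp: compl_measure_def)
  have "0 < (\<Sum>i<n. x $ i * s $ i)"
    using nb n by (intro sum_pos) auto
  moreover have "x \<bullet> s = (\<Sum>i<n. x $ i * s $ i)"
    using nb by (auto simp: scalar_prod_def atLeast0LessThan)
  ultimately have "0 < x \<bullet> s" by simp
  then have "0 < compl_measure x s" using xs n by (simp add: zero_less_mult_iff)
  then show thesis using nb xs by (intro that) auto
qed

lemma residual_carriers:
  assumes "ppm_problem m n P" "x \<in> carrier_vec n" "y \<in> carrier_vec m" "s \<in> carrier_vec n"
  shows "primal_res P x y \<in> carrier_vec m" "dual_res P x y s \<in> carrier_vec n"
  using assms by (auto simp: ppm_problem_def primal_res_def dual_res_def)

lemma sum_abs_newton_products_le: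
  assumes P: "ppm_problem m n P" and q: "valid_params q"
    and nb: "(x, y, s) \<in> neighbourhood P q" and nw: "inexact_newton P q x y s dx dy ds"
    and M: "compl_measure x s \<le> M"
  shows "(\<Sum>i<n. \<bar>dx $ i * ds $ i\<bar>)
    \<le> second_order_const (preg P) (dreg P) M q * (real n)\<^sup>2 * compl_measure x s"
proof -
  define \<mu> where "\<mu> = compl_measure x s"
  define N where "N = real n"
  from neighbourhoodE[OF nb P] have x: "x \<in> carrier_vec n" and y: "y \<in> carrier_vec m"
    and s: "s \<in> carrier_vec n" and pos: "\<And>i. i < n \<Longrightarrow> 0 < x $ i" "\<And>i. i < n \<Longrightarrow> 0 < s $ i"
    and lo: "\<And>i. i < n \<Longrightarrow> gamma_lo q * \<mu> \<le> x $ i * s $ i"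
    and rp: "gamma_p q * norm2_vec (primal_res P x y) \<le> N * \<mu>"
    and rd: "gamma_d q * norm2_vec (dual_res P x y s) \<le> N * \<mu>"
    and xs: "x \<bullet> s = N * \<mu>" and \<mu>: "0 < \<mu>"
    unfolding \<mu>_def N_def by metis+
  from inexact_newtonE[OF nw P x s] obtain z where dx: "dx \<in> carrier_vec n"
    and dy: "dy \<in> carrier_vec m" and ds: "ds \<in> carrier_vec n" and z: "z \<in> carrier_vec m"
    and zle: "norm2_vec z \<le> C_inexact q * (N * \<mu>)"
    and dual: "preg P \<cdot>\<^sub>v dx - (cmat P)\<^sup>T *\<^sub>v dy - ds = - dual_res P x y s"
    and primal: "cmat P *\<^sub>v dx + dreg P \<cdot>\<^sub>v dy = - primal_res P x y + z"
    and compl: "\<And>i. i < n \<Longrightarrow> s $ i * dx $ i + x $ i * ds $ i = sigma q * \<mu> - x $ i * s $ i"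
    unfolding xs \<mu>_def by metis
  have A: "cmat P \<in> carrier_mat m n" and reg: "0 < preg P" "0 < dreg P" and N: "1 \<le> N"
    using P by (auto simp: ppm_problem_def N_def)
  have params: "0 < gamma_lo q" "0 < gamma_p q" "0 < gamma_d q" "0 < sigma q" "sigma q < 1" "0 < C_inexact q"
    using q by (auto simp: valid_params_def)
  let ?rp = "primal_res P x y" and ?rd = "dual_res P x y s"
  let ?p = "- primal_res P x y + z"
  note car = residual_carriers[OF P x y s]
  have "norm2_vec ?p \<le> norm2_vec ?rp + norm2_vec z"
    using norm2_vec_add_le[of "- ?rp" m z] car z by (simp add: norm2_vec_uminus)
  also have "norm2_vec ?rp \<le> N * \<mu> / gamma_p q"
    using rp params by (simp add: field_simps)
  finally have "norm2_vec ?p \<le> (1 / gamma_p q + C_inexact q) * (N * \<mu>)"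
    using zle by (simp add: field_simps)
  then have p2: "(norm2_vec ?p)\<^sup>2 \<le> (1 / gamma_p q + C_inexact q)\<^sup>2 * (N * \<mu>)\<^sup>2"
    unfolding power_mult_distrib[symmetric] by (rule power_mono) (rule norm2_vec_nonneg)
  have "norm2_vec ?rd \<le> (1 / gamma_d q) * (N * \<mu>)"
    using rd params by (simp add: field_simps)
  then have d2: "(norm2_vec ?rd)\<^sup>2 \<le> (1 / gamma_d q)\<^sup>2 * (N * \<mu>)\<^sup>2"
    unfolding power_mult_distrib[symmetric] by (rule power_mono) (rule norm2_vec_nonneg)
  define E where "E = (1 / gamma_p q + C_inexact q)\<^sup>2 / (4 * dreg P) + (1 / gamma_d q)\<^sup>2 / (4 * preg P)"
  have E: "0 \<le> E" unfolding E_def using reg by (intro add_nonneg_nonneg divide_nonneg_nonneg) auto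
  \<comment> \<open>One factor \<open>\<mu>\<close> of \<open>(N \<mu>)\<^sup>2\<close> is traded for \<open>M\<close>, so that the bound is linear in \<open>\<mu>\<close>.\<close>
  have "(norm2_vec ?p)\<^sup>2 / (4 * dreg P) + (norm2_vec ?rd)\<^sup>2 / (4 * preg P)
      \<le> (1 / gamma_p q + C_inexact q)\<^sup>2 * (N * \<mu>)\<^sup>2 / (4 * dreg P)
        + (1 / gamma_d q)\<^sup>2 * (N * \<mu>)\<^sup>2 / (4 * preg P)"
    using reg by (intro add_mono divide_right_mono p2 d2) auto
  also have "\<dots> = E * N\<^sup>2 * \<mu> * \<mu>"
    unfolding E_def by (simp add: add_divide_distrib algebra_simps power2_eq_square)
  also have "\<dots> \<le> E * N\<^sup>2 * \<mu> * M"
    using E \<mu> M by (intro mult_left_mono) (auto simp: \<mu>_def)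
  finally have dot: "- (E * N\<^sup>2 * \<mu> * M) \<le> (\<Sum>i<n. dx $ i * ds $ i)"
    using regularised_scalar_prod_lower[OF A dx dy ds car(2) _ reg dual primal] car z by simp
  have \<sigma>2: "(sigma q)\<^sup>2 \<le> 1" using params by (intro power_le_one) auto
  have N2: "N \<le> N\<^sup>2" using N by (simp add: power2_eq_square)
  have "(\<Sum>i<n. 2 * \<bar>dx $ i * ds $ i\<bar> + 2 * (dx $ i * ds $ i))
      \<le> (\<Sum>i<n. (sigma q)\<^sup>2 * \<mu> / gamma_lo q + x $ i * s $ i)"
    using pos lo compl params \<mu> by (intro sum_mono abs_prod_newton_le) auto
  also have "\<dots> = N * ((sigma q)\<^sup>2 * \<mu> / gamma_lo q) + x \<bullet> s"
    using s by (simp add: sum.distrib N_def scalar_prod_def atLeast0LessThan)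
  also have "\<dots> = N * \<mu> * ((sigma q)\<^sup>2 / gamma_lo q + 1)"
    by (simp add: xs algebra_simps)
  also have "\<dots> \<le> N\<^sup>2 * \<mu> * (1 / gamma_lo q + 1)"
    using params \<mu> N \<sigma>2 N2 by (intro mult_mono add_mono divide_right_mono) auto
  finally have "2 * (\<Sum>i<n. \<bar>dx $ i * ds $ i\<bar>) + 2 * (\<Sum>i<n. dx $ i * ds $ i)
      \<le> N\<^sup>2 * \<mu> * (1 / gamma_lo q + 1)"
    by (simp add: sum.distrib sum_distrib_left)
  moreover have "a \<le> u / 2 + v" if "2 * a + 2 * b \<le> u" "- v \<le> b" for a b u v :: real
    using that by linarith
  ultimately have "(\<Sum>i<n. \<bar>dx $ i * ds $ i\<bar>) \<le> N\<^sup>2 * \<mu> * (1 / gamma_lo q + 1) / 2 + E * N\<^sup>2 * \<mu> * M"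
    using dot by blast
  also have "\<dots> = second_order_const (preg P) (dreg P) M q * N\<^sup>2 * \<mu>"
    unfolding second_order_const_def E_def[symmetric] by (simp add: field_simps)
  finally show ?thesis by (simp add: \<mu>_def N_def)
qed

section \<open>Steps that stay in the neighbourhood\<close>

lemma primal_res_along_direction:
  assumes P: "ppm_problem m n P" and x: "x \<in> carrier_vec n" and y: "y \<in> carrier_vec m"
    and dx: "dx \<in> carrier_vec n" and dy: "dy \<in> carrier_vec m" and z: "z \<in> carrier_vec m"
    and newton: "cmat P *\<^sub>v dx + dreg P \<cdot>\<^sub>v dy = - primal_res P x y + z"
  shows "primal_res P (x + \<beta> \<cdot>\<^sub>v dx) (y + \<beta> \<cdot>\<^sub>v dy) = (1 - \<beta>) \<cdot>\<^sub>v primal_res P x y + \<beta> \<cdot>\<^sub>v z"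
    (is "?l = ?r")
proof (rule eq_vecI)
  have A: "cmat P \<in> carrier_mat m n" and b: "rhs P \<in> carrier_vec m" and yk: "dcenter P \<in> carrier_vec m"
    using P by (auto simp: ppm_problem_def)
  have Adx: "cmat P *\<^sub>v (x + \<beta> \<cdot>\<^sub>v dx) = cmat P *\<^sub>v x + \<beta> \<cdot>\<^sub>v (cmat P *\<^sub>v dx)"
    using A x dx by (simp add: mult_add_distrib_mat_vec[OF A] mult_mat_vec[OF A])
  have car: "cmat P *\<^sub>v x \<in> carrier_vec m" "cmat P *\<^sub>v dx \<in> carrier_vec m"
    using mult_mat_vec_carrier[OF A] x dx by auto
  fix i assume "i < dim_vec ?r"
  then have i: "i < m" using z by simp
  have nw: "(cmat P *\<^sub>v dx) $ i + dreg P * dy $ i = - primal_res P x y $ i + z $ i"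
    using arg_cong[OF newton, of "\<lambda>v. v $ i"] i car dy z residual_carriers(1)[OF P x y x]
    by simp
  have r: "primal_res P x y $ i = (cmat P *\<^sub>v x) $ i + dreg P * (y $ i - dcenter P $ i) - rhs P $ i"
    using i b yk y car by (simp add: primal_res_def)
  have "?l $ i = (cmat P *\<^sub>v x) $ i + \<beta> * (cmat P *\<^sub>v dx) $ i
      + dreg P * (y $ i + \<beta> * dy $ i - dcenter P $ i) - rhs P $ i"
    using i b yk y dy car carrier_vecD[OF car(2)] by (simp add: primal_res_def Adx)
  also have "\<dots> = primal_res P x y $ i + \<beta> * ((cmat P *\<^sub>v dx) $ i + dreg P * dy $ i)"
    by (simp add: r algebra_simps)
  also have "\<dots> = ?r $ i"
    unfolding nw using i z residual_carriers(1)[OF P x y x] by (simp add: algebra_simps)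
  finally show "?l $ i = ?r $ i" .
next
  show "dim_vec ?l = dim_vec ?r"
    using z P by (auto simp: ppm_problem_def primal_res_def)
qed

lemma dual_res_along_direction:
  assumes P: "ppm_problem m n P" and x: "x \<in> carrier_vec n" and y: "y \<in> carrier_vec m"
    and s: "s \<in> carrier_vec n"
    and dx: "dx \<in> carrier_vec n" and dy: "dy \<in> carrier_vec m" and ds: "ds \<in> carrier_vec n"
    and newton: "preg P \<cdot>\<^sub>v dx - (cmat P)\<^sup>T *\<^sub>v dy - ds = - dual_res P x y s"
  shows "dual_res P (x + \<beta> \<cdot>\<^sub>v dx) (y + \<beta> \<cdot>\<^sub>v dy) (s + \<beta> \<cdot>\<^sub>v ds) = (1 - \<beta>) \<cdot>\<^sub>v dual_res P x y s"
    (is "?l = ?r")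
proof (rule eq_vecI)
  let ?B = "(cmat P)\<^sup>T"
  have B: "?B \<in> carrier_mat n m" and c: "cost P \<in> carrier_vec n" and xk: "pcenter P \<in> carrier_vec n"
    using P by (auto simp: ppm_problem_def)
  have Bdy: "?B *\<^sub>v (y + \<beta> \<cdot>\<^sub>v dy) = ?B *\<^sub>v y + \<beta> \<cdot>\<^sub>v (?B *\<^sub>v dy)"
    using B y dy by (simp add: mult_add_distrib_mat_vec[OF B] mult_mat_vec[OF B])
  have car: "?B *\<^sub>v y \<in> carrier_vec n" "?B *\<^sub>v dy \<in> carrier_vec n"
    using mult_mat_vec_carrier[OF B] y dy by auto
  define g h where gh: "g = ?B *\<^sub>v y" "h = ?B *\<^sub>v dy"
  note car = car[folded gh] and Bdy = Bdy[folded gh]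
  note rcar = residual_carriers(2)[OF P x y s]
  fix i assume "i < dim_vec ?r"
  then have i: "i < n" using rcar by simp
  have nw: "preg P * dx $ i - h $ i - ds $ i = - dual_res P x y s $ i"
    using arg_cong[OF newton[folded gh], of "\<lambda>v. v $ i"] i car dx ds rcar by simp
  have r: "dual_res P x y s $ i = preg P * (x $ i - pcenter P $ i) - g $ i - s $ i + cost P $ i"
    using i c xk x s car by (simp add: dual_res_def gh[symmetric])
  have "?l $ i = preg P * (x $ i + \<beta> * dx $ i - pcenter P $ i) - (g $ i + \<beta> * h $ i)
      - (s $ i + \<beta> * ds $ i) + cost P $ i"
    using i c xk x dx s ds car by (simp add: dual_res_def Bdy)
  also have "\<dots> = dual_res P x y s $ i + \<beta> * (preg P * dx $ i - h $ i - ds $ i)"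
    by (simp add: r algebra_simps)
  also have "\<dots> = ?r $ i"
    unfolding nw using i rcar by (simp add: algebra_simps)
  finally show "?l $ i = ?r $ i" .
next
  show "dim_vec ?l = dim_vec ?r"
    using P by (auto simp: ppm_problem_def dual_res_def)
qed

text \<open>
  If the second-order products sum to at most \<open>D\<close>, then steps \<open>b\<close> in \<open>[0, 1]\<close> with \<open>b D \<le> step_const q \<mu>\<close> are
  acceptable. The four terms are the first-order slacks in the lower and the upper centrality
  condition, the primal residual condition and the decrease condition. The dual residual condition
  and positivity of the complementarity measure follow from the first one.
\<close>

definition step_const :: "ipm_params \<Rightarrow> real" where
  "step_const q = min
     (min (sigma q * (1 - gamma_lo q) / 2) (sigma q * (gamma_up q - 1) / (1 + gamma_up q)))
     (min (sigma q - gamma_p q * C_inexact q) (sigma_bar q - sigma q))"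

lemma step_const_pos: "valid_params q \<Longrightarrow> 0 < step_const q"
  by (simp add: valid_params_def step_const_def)

lemma step_const_le:
  assumes "valid_params q"
  shows "step_const q \<le> sigma q / 2"
    "step_const q * (1 + gamma_lo q) \<le> sigma q * (1 - gamma_lo q)"
    "step_const q * (1 + gamma_up q) \<le> sigma q * (gamma_up q - 1)"
    "step_const q \<le> sigma q - gamma_p q * C_inexact q"
    "step_const q \<le> sigma_bar q - sigma q"
proof -
  have g: "0 < gamma_lo q" "gamma_lo q < 1" "0 < sigma q" "1 < gamma_up q" "0 < step_const q"
    using assms step_const_pos by (auto simp: valid_params_def)
  have 1: "step_const q \<le> sigma q * (1 - gamma_lo q) / 2" unfolding step_const_def by linarith
  also have "\<dots> \<le> sigma q / 2" using g by simp
  finally show "step_const q \<le> sigma q / 2" .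
  have "step_const q * (1 + gamma_lo q) \<le> step_const q * 2" using g by simp
  also have "\<dots> \<le> sigma q * (1 - gamma_lo q)" using 1 by simp
  finally show "step_const q * (1 + gamma_lo q) \<le> sigma q * (1 - gamma_lo q)" .
  have "step_const q \<le> sigma q * (gamma_up q - 1) / (1 + gamma_up q)" unfolding step_const_def by linarith
  then show "step_const q * (1 + gamma_up q) \<le> sigma q * (gamma_up q - 1)"
    using g by (simp add: pos_le_divide_eq)
qed (auto simp: step_const_def)

text \<open>
  A factor that is affine in \<open>\<beta>\<close> and starts positive cannot change sign while the product stays
  positive.
\<close>

lemma positive_along_segment:
  fixes x dx s ds b :: real
  assumes "0 < x" and "0 \<le> b"
    and prod: "\<And>\<beta>. 0 \<le> \<beta> \<Longrightarrow> \<beta> \<le> b \<Longrightarrow> 0 < (x + \<beta> * dx) * (s + \<beta> * ds)"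
  shows "0 < x + b * dx"
proof (rule ccontr)
  assume "\<not> 0 < x + b * dx"
  then have le: "x + b * dx \<le> 0" by simp
  then have "0 < b" "dx < 0"
    using assms(1,2) by (smt (verit) mult_nonneg_nonneg mult_eq_0_iff)+
  then have "x + (x / - dx) * dx = 0" "0 \<le> x / - dx" "x / - dx \<le> b"
    using le assms(1) by (auto simp: field_simps)
  then show False using prod[of "x / - dx"] by simp
qed

lemma newton_step_in_neighbourhood:
  assumes P: "ppm_problem m n P" and q: "valid_params q"
    and nb: "(x, y, s) \<in> neighbourhood P q" and nw: "inexact_newton P q x y s dx dy ds"
    and D: "(\<Sum>i<n. \<bar>dx $ i * ds $ i\<bar>) \<le> D"
    and b: "0 \<le> b" "b \<le> 1" "b * D \<le> step_const q * compl_measure x s"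
  shows "(x + b \<cdot>\<^sub>v dx, y + b \<cdot>\<^sub>v dy, s + b \<cdot>\<^sub>v ds) \<in> neighbourhood P q"
    and "(x + b \<cdot>\<^sub>v dx) \<bullet> (s + b \<cdot>\<^sub>v ds) \<le> (1 - (1 - sigma_bar q) * b) * (x \<bullet> s)"
proof -
  define \<mu> where "\<mu> = compl_measure x s"
  define N where "N = real n"
  define \<theta> where "\<theta> = step_const q"
  from neighbourhoodE[OF nb P] have x: "x \<in> carrier_vec n" and y: "y \<in> carrier_vec m"
    and s: "s \<in> carrier_vec n" and pos: "\<And>i. i < n \<Longrightarrow> 0 < x $ i" "\<And>i. i < n \<Longrightarrow> 0 < s $ i"
    and up: "\<And>i. i < n \<Longrightarrow> x $ i * s $ i \<le> gamma_up q * \<mu>"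
    and lo: "\<And>i. i < n \<Longrightarrow> gamma_lo q * \<mu> \<le> x $ i * s $ i"
    and rp: "gamma_p q * norm2_vec (primal_res P x y) \<le> N * \<mu>"
    and rd: "gamma_d q * norm2_vec (dual_res P x y s) \<le> N * \<mu>"
    and xs: "x \<bullet> s = N * \<mu>" and \<mu>: "0 < \<mu>"
    unfolding \<mu>_def N_def by metis+
  from inexact_newtonE[OF nw P x s] obtain z where dx: "dx \<in> carrier_vec n"
    and dy: "dy \<in> carrier_vec m" and ds: "ds \<in> carrier_vec n" and z: "z \<in> carrier_vec m"
    and zle: "norm2_vec z \<le> C_inexact q * (N * \<mu>)"
    and dual: "preg P \<cdot>\<^sub>v dx - (cmat P)\<^sup>T *\<^sub>v dy - ds = - dual_res P x y s"
    and primal: "cmat P *\<^sub>v dx + dreg P \<cdot>\<^sub>v dy = - primal_res P x y + z"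
    and compl: "\<And>i. i < n \<Longrightarrow> s $ i * dx $ i + x $ i * ds $ i = sigma q * \<mu> - x $ i * s $ i"
    unfolding xs \<mu>_def by metis
  have N: "1 \<le> N" and n: "0 < n" and dims: "ppm_rows P = m" "ppm_cols P = n"
    using P by (auto simp: ppm_problem_def N_def)
  have params: "0 < gamma_lo q" "gamma_lo q < 1" "1 < gamma_up q" "0 < gamma_p q" "0 < gamma_d q"
    "0 < sigma q" "sigma q < 1" "0 < C_inexact q"
    using q by (auto simp: valid_params_def)
  note \<theta> = step_const_pos[OF q, folded \<theta>_def] step_const_le[OF q, folded \<theta>_def]
  define S where "S = (\<Sum>i<n. dx $ i * ds $ i)"
  have "\<bar>S\<bar> \<le> (\<Sum>i<n. \<bar>dx $ i * ds $ i\<bar>)" unfolding S_def by (rule sum_abs)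
  then have S: "\<bar>S\<bar> \<le> D" using D by simp
  have comp_D: "\<bar>dx $ i * ds $ i\<bar> \<le> D" if "i < n" for i
    using member_le_sum[of i "{..<n}" "\<lambda>i. \<bar>dx $ i * ds $ i\<bar>"] that D by simp
  have comp: "(x $ i + \<beta> * dx $ i) * (s $ i + \<beta> * ds $ i)
      = (1 - \<beta>) * (x $ i * s $ i) + \<beta> * (sigma q * \<mu>) + \<beta>\<^sup>2 * (dx $ i * ds $ i)" if "i < n" for i \<beta>
  proof -
    have "(x $ i + \<beta> * dx $ i) * (s $ i + \<beta> * ds $ i)
      = x $ i * s $ i + \<beta> * (s $ i * dx $ i + x $ i * ds $ i) + \<beta>\<^sup>2 * (dx $ i * ds $ i)"
      by (simp add: power2_eq_square algebra_simps)
    then show ?thesis unfolding compl[OF that] by (simp add: algebra_simps)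
  qed
  have dot: "(x + \<beta> \<cdot>\<^sub>v dx) \<bullet> (s + \<beta> \<cdot>\<^sub>v ds) = N * ((1 - \<beta>) * \<mu> + \<beta> * (sigma q * \<mu>)) + \<beta>\<^sup>2 * S" for \<beta>
  proof -
    have "(x + \<beta> \<cdot>\<^sub>v dx) \<bullet> (s + \<beta> \<cdot>\<^sub>v ds) = (\<Sum>i<n. (x $ i + \<beta> * dx $ i) * (s $ i + \<beta> * ds $ i))"
      using x s dx ds by (auto simp: scalar_prod_def atLeast0LessThan intro!: sum.cong)
    also have "\<dots> = (\<Sum>i<n. (1 - \<beta>) * (x $ i * s $ i) + \<beta> * (sigma q * \<mu>) + \<beta>\<^sup>2 * (dx $ i * ds $ i))"
      by (rule sum.cong) (auto simp: comp)
    also have "\<dots> = (1 - \<beta>) * (x \<bullet> s) + N * (\<beta> * (sigma q * \<mu>)) + \<beta>\<^sup>2 * S"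
      using s by (simp add: sum.distrib S_def N_def sum_distrib_left scalar_prod_def atLeast0LessThan)
    finally show ?thesis by (simp add: xs algebra_simps)
  qed
  define T where "T = S / N"
  define \<mu>' where "\<mu>' \<beta> = compl_measure (x + \<beta> \<cdot>\<^sub>v dx) (s + \<beta> \<cdot>\<^sub>v ds)" for \<beta>
  have \<mu>': "\<mu>' \<beta> = (1 - \<beta>) * \<mu> + \<beta> * (sigma q * \<mu>) + \<beta>\<^sup>2 * T" for \<beta>
    using dx N unfolding \<mu>'_def compl_measure_def dot T_def by (simp add: field_simps N_def)
  have "\<bar>S\<bar> * 1 \<le> D * N" using S N by (intro mult_mono) auto
  then have SN: "\<bar>T\<bar> \<le> D" unfolding T_def using N by (simp add: field_simps)
  \<comment> \<open>Any second-order quantity bounded by \<open>D\<close> contributes at most \<open>\<beta> \<theta> \<mu>\<close>, a first-order amount.\<close>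
  have small: "\<beta>\<^sup>2 * t \<le> \<beta> * (\<theta> * \<mu>)" "- (\<beta> * (\<theta> * \<mu>)) \<le> \<beta>\<^sup>2 * t"
    if "0 \<le> \<beta>" "\<beta> \<le> b" "\<bar>t\<bar> \<le> D" for \<beta> t
  proof -
    have "\<bar>\<beta>\<^sup>2 * t\<bar> = \<beta> * (\<beta> * \<bar>t\<bar>)" using that by (simp add: abs_mult power2_eq_square)
    also have "\<dots> \<le> \<beta> * (b * D)" using that by (intro mult_left_mono mult_mono) auto
    also have "\<dots> \<le> \<beta> * (\<theta> * \<mu>)"
      using that b by (intro mult_left_mono) (auto simp: \<theta>_def \<mu>_def)
    finally show "\<beta>\<^sup>2 * t \<le> \<beta> * (\<theta> * \<mu>)" "- (\<beta> * (\<theta> * \<mu>)) \<le> \<beta>\<^sup>2 * t" by auto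
  qed
  have lo': "gamma_lo q * \<mu>' \<beta> \<le> (x $ i + \<beta> * dx $ i) * (s $ i + \<beta> * ds $ i)"
    if i: "i < n" and \<beta>: "0 \<le> \<beta>" "\<beta> \<le> b" for i \<beta>
  proof -
    have "(1 - \<beta>) * (gamma_lo q * \<mu>) \<le> (1 - \<beta>) * (x $ i * s $ i)"
      using lo[OF i] \<beta> b by (intro mult_left_mono) auto
    moreover have "gamma_lo q * (\<beta>\<^sup>2 * T) \<le> gamma_lo q * (\<beta> * (\<theta> * \<mu>))"
      using small(1)[OF \<beta> SN] params by (intro mult_left_mono) auto
    moreover have "\<beta> * \<mu> * (\<theta> * (1 + gamma_lo q)) \<le> \<beta> * \<mu> * (sigma q * (1 - gamma_lo q))"
      using \<theta>(3) \<beta> \<mu> by (intro mult_left_mono) auto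
    ultimately show ?thesis
      unfolding comp[OF i] \<mu>' using small(2)[OF \<beta> comp_D[OF i]] by (simp add: algebra_simps)
  qed
  have up': "(x $ i + \<beta> * dx $ i) * (s $ i + \<beta> * ds $ i) \<le> gamma_up q * \<mu>' \<beta>"
    if i: "i < n" and \<beta>: "0 \<le> \<beta>" "\<beta> \<le> b" for i \<beta>
  proof -
    have "(1 - \<beta>) * (x $ i * s $ i) \<le> (1 - \<beta>) * (gamma_up q * \<mu>)"
      using up[OF i] \<beta> b by (intro mult_left_mono) auto
    moreover have "gamma_up q * - (\<beta> * (\<theta> * \<mu>)) \<le> gamma_up q * (\<beta>\<^sup>2 * T)"
      using small(2)[OF \<beta> SN] params by (intro mult_left_mono) auto
    moreover have "\<beta> * \<mu> * (\<theta> * (1 + gamma_up q)) \<le> \<beta> * \<mu> * (sigma q * (gamma_up q - 1))"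
      using \<theta>(4) \<beta> \<mu> by (intro mult_left_mono) auto
    ultimately show ?thesis
      unfolding comp[OF i] \<mu>' using small(1)[OF \<beta> comp_D[OF i]] by (simp add: algebra_simps)
  qed
  have \<mu>'_pos: "0 < \<mu>' \<beta>" if \<beta>: "0 \<le> \<beta>" "\<beta> \<le> b" for \<beta>
  proof -
    have "\<beta> * (\<theta> * \<mu>) \<le> \<beta> * (sigma q / 2 * \<mu>)"
      using \<theta>(2) \<beta> \<mu> by (intro mult_left_mono mult_right_mono) auto
    then have "\<mu> * ((1 - \<beta>) + \<beta> * (sigma q / 2)) \<le> \<mu>' \<beta>"
      unfolding \<mu>' using small(2)[OF \<beta> SN] by (simp add: algebra_simps)
    moreover have "0 < (1 - \<beta>) + \<beta> * (sigma q / 2)"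
    proof (cases "\<beta> = 1")
      case False
      then show ?thesis using \<beta> b params by (intro add_pos_nonneg) auto
    qed (use params in simp)
    ultimately show ?thesis using \<mu> by (smt (verit) mult_pos_pos)
  qed
  have prod_pos: "0 < (x $ i + \<beta> * dx $ i) * (s $ i + \<beta> * ds $ i)"
    if "i < n" "0 \<le> \<beta>" "\<beta> \<le> b" for i \<beta>
    using lo'[OF that] \<mu>'_pos[OF that(2,3)] params by (smt (verit) mult_pos_pos)
  \<comment> \<open>A positive product alone would allow both factors to be negative; hence the passage along
    the whole segment from \<open>0\<close> to \<open>b\<close>.\<close>
  have x_pos: "0 < x $ i + b * dx $ i" if "i < n" for i
    using positive_along_segment[OF pos(1)[OF that] b(1)] prod_pos[OF that] by blast
  have s_pos: "0 < s $ i + b * ds $ i" if "i < n" for i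
    using x_pos[OF that] prod_pos[OF that b(1)] by (simp add: zero_less_mult_iff)
  have "\<mu> * N * (b * \<theta>) \<ge> b * (\<theta> * \<mu>)"
    using mult_right_mono[OF N, of "\<mu> * (b * \<theta>)"] b \<mu> \<theta>(1) by (simp add: algebra_simps)
  then have bS: "- (N * \<mu> * (b * \<theta>)) \<le> b\<^sup>2 * S" "b\<^sup>2 * S \<le> N * \<mu> * (b * \<theta>)"
    using small[OF b(1) order_refl S] by (auto simp: algebra_simps)
  \<comment> \<open>Used with \<open>c = \<gamma>\<^sub>p C\<close>, the inexactness, for the primal residual and with \<open>c = 0\<close> for the dual one.\<close>
  have dot_lower: "N * \<mu> * ((1 - b) + b * c) \<le> (x + b \<cdot>\<^sub>v dx) \<bullet> (s + b \<cdot>\<^sub>v ds)"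
    if "\<theta> \<le> sigma q - c" for c
  proof -
    have "N * \<mu> * (b * \<theta>) \<le> N * \<mu> * (b * (sigma q - c))"
      using that b \<mu> N by (intro mult_left_mono) auto
    then show ?thesis unfolding dot using bS(1) by (simp add: algebra_simps)
  qed
  note rcar = residual_carriers[OF P x y s]
  have "norm2_vec (primal_res P (x + b \<cdot>\<^sub>v dx) (y + b \<cdot>\<^sub>v dy))
      \<le> (1 - b) * norm2_vec (primal_res P x y) + b * norm2_vec z"
    unfolding primal_res_along_direction[OF P x y dx dy z primal]
    using norm2_vec_add_le[of "(1 - b) \<cdot>\<^sub>v primal_res P x y" m "b \<cdot>\<^sub>v z"] rcar z b
    by (simp add: norm2_vec_smult)
  then have "gamma_p q * norm2_vec (primal_res P (x + b \<cdot>\<^sub>v dx) (y + b \<cdot>\<^sub>v dy))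
      \<le> gamma_p q * ((1 - b) * norm2_vec (primal_res P x y) + b * norm2_vec z)"
    using params by (intro mult_left_mono) auto
  also have "\<dots> = (1 - b) * (gamma_p q * norm2_vec (primal_res P x y)) + gamma_p q * b * norm2_vec z"
    by (simp add: algebra_simps)
  also have "\<dots> \<le> (1 - b) * (N * \<mu>) + gamma_p q * b * (C_inexact q * (N * \<mu>))"
    using b params by (intro add_mono mult_left_mono rp zle) auto
  also have "\<dots> = N * \<mu> * ((1 - b) + b * (gamma_p q * C_inexact q))"
    by (simp add: algebra_simps)
  also have "\<dots> \<le> (x + b \<cdot>\<^sub>v dx) \<bullet> (s + b \<cdot>\<^sub>v ds)"
    using dot_lower \<theta>(5) by simp
  finally have rp': "gamma_p q * norm2_vec (primal_res P (x + b \<cdot>\<^sub>v dx) (y + b \<cdot>\<^sub>v dy))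
      \<le> (x + b \<cdot>\<^sub>v dx) \<bullet> (s + b \<cdot>\<^sub>v ds)" .
  have "gamma_d q * norm2_vec (dual_res P (x + b \<cdot>\<^sub>v dx) (y + b \<cdot>\<^sub>v dy) (s + b \<cdot>\<^sub>v ds))
      = (1 - b) * (gamma_d q * norm2_vec (dual_res P x y s))"
    unfolding dual_res_along_direction[OF P x y s dx dy ds dual]
    using b by (simp add: norm2_vec_smult)
  also have "\<dots> \<le> (1 - b) * (N * \<mu>)"
    using b by (intro mult_left_mono rd) auto
  also have "\<dots> \<le> (x + b \<cdot>\<^sub>v dx) \<bullet> (s + b \<cdot>\<^sub>v ds)"
    using dot_lower[of 0] \<theta>(2) params by (simp add: mult.commute)
  finally have rd': "gamma_d q * norm2_vec (dual_res P (x + b \<cdot>\<^sub>v dx) (y + b \<cdot>\<^sub>v dy) (s + b \<cdot>\<^sub>v ds))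
      \<le> (x + b \<cdot>\<^sub>v dx) \<bullet> (s + b \<cdot>\<^sub>v ds)" .
  show "(x + b \<cdot>\<^sub>v dx, y + b \<cdot>\<^sub>v dy, s + b \<cdot>\<^sub>v ds) \<in> neighbourhood P q"
    using x y s dx dy ds x_pos s_pos rp' rd' lo'[OF _ b(1) order_refl] up'[OF _ b(1) order_refl]
    by (auto simp: neighbourhood_def dims \<mu>'_def)
  have "N * \<mu> * (b * \<theta>) \<le> N * \<mu> * (b * (sigma_bar q - sigma q))"
    using \<theta>(6) b \<mu> N by (intro mult_left_mono) auto
  then show "(x + b \<cdot>\<^sub>v dx) \<bullet> (s + b \<cdot>\<^sub>v ds) \<le> (1 - (1 - sigma_bar q) * b) * (x \<bullet> s)"
    unfolding dot xs using bS(2) by (simp add: algebra_simps)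
qed

lemma step_in_admissible_steps:
  assumes P: "ppm_problem m n P" and q: "valid_params q"
    and nb: "(x, y, s) \<in> neighbourhood P q" and nw: "inexact_newton P q x y s dx dy ds"
    and M: "compl_measure x s \<le> M"
  shows "step_const q / (second_order_const (preg P) (dreg P) M q * (real n)\<^sup>2)
    \<in> admissible_steps P q x y s dx dy ds"
proof -
  define \<mu> where "\<mu> = compl_measure x s"
  define c where "c = second_order_const (preg P) (dreg P) M q"
  define a where "a = step_const q / (c * (real n)\<^sup>2)"
  have reg: "0 < preg P" "0 < dreg P" and n: "1 \<le> real n"
    using P by (auto simp: ppm_problem_def)
  from neighbourhoodE[OF nb P] have \<mu>: "0 < \<mu>" unfolding \<mu>_def by metis
  have c: "1 \<le> c"
    unfolding c_def using q reg M \<mu> by (intro second_order_const_ge_1) (auto simp: \<mu>_def)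
  have "1 * 1 \<le> c * (real n)\<^sup>2" using c n by (intro mult_mono) auto
  then have cn: "1 \<le> c * (real n)\<^sup>2" by simp
  have th: "0 < step_const q" "step_const q \<le> 1"
    using step_const_pos[OF q] step_const_le(1)[OF q] q by (auto simp: valid_params_def)
  have a: "0 \<le> a" "a \<le> 1" "a * (c * (real n)\<^sup>2 * \<mu>) = step_const q * \<mu>"
    using th cn by (auto simp: a_def field_simps)
  have step: "b * (c * (real n)\<^sup>2 * \<mu>) \<le> step_const q * \<mu>" if "b \<le> a" for b
  proof -
    have "b * (c * (real n)\<^sup>2 * \<mu>) \<le> a * (c * (real n)\<^sup>2 * \<mu>)"
      using that cn \<mu> by (intro mult_right_mono) auto
    then show ?thesis using a by simp
  qed
  note sum_le = sum_abs_newton_products_le[OF P q nb nw M, folded c_def \<mu>_def]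
  note in_nb = newton_step_in_neighbourhood[OF P q nb nw sum_le, folded \<mu>_def]
  have "a \<in> admissible_steps P q x y s dx dy ds"
    unfolding admissible_steps_def using a(1,2) in_nb step by auto
  then show ?thesis by (simp add: a_def c_def)
qed

section \<open>Linear convergence of the complementarity measure\<close>

lemma run_in_neighbourhood:
  assumes "infinite_ipm_run P q x y s"
  shows "(x j, y j, s j) \<in> neighbourhood P q"
proof (cases j)
  case 0
  then show ?thesis using assms by (simp add: infinite_ipm_run_def)
next
  case (Suc i)
  from assms obtain dx dy ds \<alpha>
    where "\<alpha> \<in> admissible_steps P q (x i) (y i) (s i) dx dy ds"
      and "x (Suc i) = x i + \<alpha> \<cdot>\<^sub>v dx" "y (Suc i) = y i + \<alpha> \<cdot>\<^sub>v dy" "s (Suc i) = s i + \<alpha> \<cdot>\<^sub>v ds"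
    unfolding infinite_ipm_run_def by blast
  then show ?thesis by (auto simp: Suc admissible_steps_def)
qed

lemma compl_measure_Suc_le:
  assumes P: "ppm_problem m n P" and q: "valid_params q" and run: "infinite_ipm_run P q x y s"
    and M: "compl_measure (x j) (s j) \<le> M"
  shows "compl_measure (x (Suc j)) (s (Suc j)) \<le>
    (1 - (1 - sigma_bar q) * (step_const q / (second_order_const (preg P) (dreg P) M q * (real n)\<^sup>2)))
      * compl_measure (x j) (s j)"
proof -
  note nb = run_in_neighbourhood[OF run]
  from run obtain dx dy ds \<alpha>
    where nw: "inexact_newton P q (x j) (y j) (s j) dx dy ds"
      and adm: "\<alpha> \<in> admissible_steps P q (x j) (y j) (s j) dx dy ds"
      and max: "\<forall>\<beta> \<in> admissible_steps P q (x j) (y j) (s j) dx dy ds. \<beta> \<le> \<alpha>"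
      and x': "x (Suc j) = x j + \<alpha> \<cdot>\<^sub>v dx" and s': "s (Suc j) = s j + \<alpha> \<cdot>\<^sub>v ds"
    unfolding infinite_ipm_run_def by blast
  define a where "a = step_const q / (second_order_const (preg P) (dreg P) M q * (real n)\<^sup>2)"
  have a: "a \<le> \<alpha>"
    using max step_in_admissible_steps[OF P q nb nw M] by (simp add: a_def)
  have n: "0 < real n" using P by (auto simp: ppm_problem_def)
  have xs: "x i \<bullet> s i = real n * compl_measure (x i) (s i)" "0 < compl_measure (x i) (s i)" for i
    using neighbourhoodE[OF nb P] by metis+
  have "x (Suc j) \<bullet> s (Suc j) \<le> (1 - (1 - sigma_bar q) * \<alpha>) * (x j \<bullet> s j)"
    using adm by (auto simp: admissible_steps_def x' s')
  also have "\<dots> \<le> (1 - (1 - sigma_bar q) * a) * (x j \<bullet> s j)"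
    using a q n xs(2)[of j] unfolding xs(1)
    by (intro mult_right_mono diff_left_mono mult_left_mono) (auto simp: valid_params_def)
  finally show ?thesis
    unfolding xs(1) using n by (simp add: a_def mult.left_commute)
qed

lemma compl_measure_le_exp:
  assumes P: "ppm_problem m n P" and q: "valid_params q" and run: "infinite_ipm_run P q x y s"
  shows "compl_measure (x j) (s j) \<le> compl_measure (x 0) (s 0) *
    exp (- (real j * ((1 - sigma_bar q) * step_const q
      / second_order_const (preg P) (dreg P) (compl_measure (x 0) (s 0)) q / (real n)\<^sup>2)))"
proof (induction j)
  case (Suc j)
  define \<mu> where "\<mu> i = compl_measure (x i) (s i)" for i
  define c where "c = second_order_const (preg P) (dreg P) (\<mu> 0) q"
  define k where "k = (1 - sigma_bar q) * step_const q / c / (real n)\<^sup>2"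
  have IH: "\<mu> j \<le> \<mu> 0 * exp (- (real j * k))"
    using Suc by (simp add: \<mu>_def k_def c_def)
  have \<mu>: "0 < \<mu> i" for i
    using neighbourhoodE[OF run_in_neighbourhood[OF run] P] unfolding \<mu>_def by metis
  have "1 \<le> c"
    unfolding c_def using q P \<mu>[of 0] by (intro second_order_const_ge_1) (auto simp: ppm_problem_def)
  then have "0 \<le> k"
    using step_const_pos[OF q] q by (auto simp: k_def valid_params_def)
  then have "\<mu> 0 * exp (- (real j * k)) \<le> \<mu> 0 * 1"
    using \<mu>[of 0] by (intro mult_left_mono) auto
  with IH have "\<mu> j \<le> \<mu> 0" by simp
  from compl_measure_Suc_le[OF P q run this[unfolded \<mu>_def], folded \<mu>_def, folded c_def]
  have "\<mu> (Suc j) \<le> (1 - k) * \<mu> j" by (simp add: k_def)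
  also have "\<dots> \<le> exp (- k) * \<mu> j"
    using exp_ge_add_one_self[of "- k"] \<mu>[of j] by (intro mult_right_mono) auto
  also have "\<dots> \<le> exp (- k) * (\<mu> 0 * exp (- (real j * k)))"
    using IH by (intro mult_left_mono) auto
  also have "\<dots> = \<mu> 0 * exp (- (real (Suc j) * k))"
    by (simp add: exp_add[symmetric] algebra_simps)
  finally show ?case by (simp add: \<mu>_def k_def c_def)
qed simp

theorem theorem5:
  fixes \<rho> \<delta> normA \<mu>0 :: real and q :: ipm_params
  assumes "0 < \<rho>" and "0 < \<delta>" and "valid_params q"
  shows "\<exists>\<epsilon>0 C :: real. 0 < \<epsilon>0 \<and> \<epsilon>0 < 1 \<and> 0 < C \<and>
    (\<forall>(m :: nat) (n :: nat) (P :: ppm) (x :: nat \<Rightarrow> real vec) (y :: nat \<Rightarrow> real vec) (s :: nat \<Rightarrow> real vec).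
       ppm_problem m n P \<and> preg P = \<rho> \<and> dreg P = \<delta> \<and> spectral_norm (cmat P) = normA \<and>
       infinite_ipm_run P q x y s \<and> compl_measure (x 0) (s 0) = \<mu>0
       \<longrightarrow> (\<exists>K :: real \<Rightarrow> nat.
             (\<forall>\<epsilon> > 0. \<forall>j \<ge> K \<epsilon>. compl_measure (x j) (s j) \<le> \<epsilon>) \<and>
             (\<forall>\<epsilon>. 0 < \<epsilon> \<and> \<epsilon> \<le> \<epsilon>0 \<longrightarrow> real (K \<epsilon>) \<le> C * (real n)\<^sup>2 * ln (1 / \<epsilon>))))"
proof -
  \<comment> \<open>The constants are fixed before any run is given, so \<open>\<mu>0 > 0\<close> is not yet available; the absolute
    value makes \<open>second_order_const_ge_1\<close> applicable.\<close>
  define c where "c = second_order_const \<rho> \<delta> \<bar>\<mu>0\<bar> q"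
  define \<kappa> where "\<kappa> = (1 - sigma_bar q) * step_const q / c"
  have "1 \<le> c" unfolding c_def using assms by (intro second_order_const_ge_1) auto
  then have \<kappa>: "0 < \<kappa>"
    using step_const_pos[OF assms(3)] assms(3) by (simp add: \<kappa>_def valid_params_def)
  \<comment> \<open>For \<open>\<epsilon> \<le> exp (- 1)\<close> one has \<open>ln (1 / \<epsilon>) \<ge> 1\<close>, which lets \<open>C\<close> absorb \<open>ln \<mu>0\<close> and the
    rounding up in \<open>K\<close>.\<close>
  define C where "C = (1 + \<bar>ln \<mu>0\<bar>) / \<kappa> + 1"
  have "0 < C" using \<kappa> by (simp add: C_def add_nonneg_pos)
  moreover have "\<exists>K :: real \<Rightarrow> nat.
      (\<forall>\<epsilon> > 0. \<forall>j \<ge> K \<epsilon>. compl_measure (x j) (s j) \<le> \<epsilon>) \<and>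
      (\<forall>\<epsilon>. 0 < \<epsilon> \<and> \<epsilon> \<le> exp (- 1) \<longrightarrow> real (K \<epsilon>) \<le> C * (real n)\<^sup>2 * ln (1 / \<epsilon>))"
    if P: "ppm_problem m n P" and reg: "preg P = \<rho>" "dreg P = \<delta>"
      and run: "infinite_ipm_run P q x y s" and start: "compl_measure (x 0) (s 0) = \<mu>0"
    for m n P x y s
  proof -
    have n: "1 \<le> real n" using P by (auto simp: ppm_problem_def)
    then have n2: "1 \<le> (real n)\<^sup>2" by simp
    have \<mu>0: "0 < \<mu>0"
      using neighbourhoodE[OF run_in_neighbourhood[OF run] P] start by metis
    have decay: "compl_measure (x j) (s j) \<le> \<mu>0 * exp (- (real j * (\<kappa> / (real n)\<^sup>2)))" for j
      using compl_measure_le_exp[OF P assms(3) run, of j] \<mu>0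
      by (simp add: reg start \<kappa>_def c_def)
    define K where "K \<epsilon> = nat \<lceil>(real n)\<^sup>2 / \<kappa> * ln (\<mu>0 / \<epsilon>)\<rceil>" for \<epsilon> :: real
    have "compl_measure (x j) (s j) \<le> \<epsilon>" if \<epsilon>: "0 < \<epsilon>" and j: "K \<epsilon> \<le> j" for \<epsilon> j
    proof -
      have "(real n)\<^sup>2 / \<kappa> * ln (\<mu>0 / \<epsilon>) \<le> real j"
        using j unfolding K_def by linarith
      then have "ln (\<mu>0 / \<epsilon>) \<le> real j * (\<kappa> / (real n)\<^sup>2)"
        using \<kappa> n by (simp add: field_simps)
      then have "\<mu>0 * exp (- (real j * (\<kappa> / (real n)\<^sup>2))) \<le> \<mu>0 * exp (- ln (\<mu>0 / \<epsilon>))"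
        using \<mu>0 by (intro mult_left_mono) auto
      also have "\<dots> = \<epsilon>" using \<mu>0 \<epsilon> by (simp add: exp_minus)
      finally show ?thesis using decay[of j] by simp
    qed
    moreover have "real (K \<epsilon>) \<le> C * (real n)\<^sup>2 * ln (1 / \<epsilon>)" if \<epsilon>: "0 < \<epsilon>" "\<epsilon> \<le> exp (- 1)" for \<epsilon>
    proof -
      have "ln \<epsilon> \<le> ln (exp (- 1))" using \<epsilon> by (subst ln_le_cancel_iff) auto
      then have L: "1 \<le> ln (1 / \<epsilon>)" using \<epsilon> by (simp add: ln_div)
      have "ln (\<mu>0 / \<epsilon>) = ln \<mu>0 + ln (1 / \<epsilon>)" using \<epsilon> \<mu>0 by (simp add: ln_div)
      also have "\<dots> \<le> \<bar>ln \<mu>0\<bar> * ln (1 / \<epsilon>) + ln (1 / \<epsilon>)"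
        using mult_left_mono[OF L, of "\<bar>ln \<mu>0\<bar>"] by linarith
      finally have "(real n)\<^sup>2 / \<kappa> * ln (\<mu>0 / \<epsilon>) \<le> (real n)\<^sup>2 / \<kappa> * ((1 + \<bar>ln \<mu>0\<bar>) * ln (1 / \<epsilon>))"
        using \<kappa> by (intro mult_left_mono) (auto simp: algebra_simps)
      moreover have "0 \<le> (real n)\<^sup>2 / \<kappa> * ((1 + \<bar>ln \<mu>0\<bar>) * ln (1 / \<epsilon>))"
        using \<kappa> L by (intro mult_nonneg_nonneg) auto
      ultimately have "real (K \<epsilon>) \<le> (real n)\<^sup>2 / \<kappa> * ((1 + \<bar>ln \<mu>0\<bar>) * ln (1 / \<epsilon>)) + 1"
        unfolding K_def by linarith
      moreover have "1 * 1 \<le> (real n)\<^sup>2 * ln (1 / \<epsilon>)"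
        using n2 L by (intro mult_mono) auto
      ultimately have "real (K \<epsilon>) \<le> (real n)\<^sup>2 / \<kappa> * ((1 + \<bar>ln \<mu>0\<bar>) * ln (1 / \<epsilon>)) + (real n)\<^sup>2 * ln (1 / \<epsilon>)"
        by linarith
      also have "\<dots> = C * (real n)\<^sup>2 * ln (1 / \<epsilon>)"
        by (simp add: C_def algebra_simps add_divide_distrib)
      finally show ?thesis .
    qed
    ultimately show ?thesis by blast
  qed
  ultimately show ?thesis
    by (intro exI[of _ "exp (- 1)"] exI[of _ C]) auto
qed

end
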